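(* The following identities hold, where $\mathfrak{d}_{2m}$, $\mathfrak{d}_{2m+1}$, $\mathfrak{d}_5'$ are the complex Lie algebras defined in the context: 1. for $m\ge 3$, $\mathcal{N}(\mathfrak{d}_{2m})=m-2$; 2. for $m\ge 2$, $\mathcal{N}(\mathfrak{d}_{2m+1})=m-1$; 3. $\mathcal{N}(\mathfrak{d}_{5}')=1$.
   Context: All Lie algebras are over $\mathbb{C}$; brackets of basis elements that are not written are zero or obtained by antisymmetry. For a Lie algebra $\mathfrak{g}$ with basis $Z_1,\dots,Z_n$, $[Z_i,Z_j]=\sum_kC_{ij}^kZ_k$, and corresponding coordinates $z_1,\dots,z_n$ on $\mathfrak{g}^*$, $\mathcal{N}(\mathfrak{g})$ is the number of functionally independent invariants of the coadjoint representation, given by the Beltrametti–Blasi formula $\mathcal{N}(\mathfrak{g})=\dim\mathfrak{g}-r(\mathfrak{g})$, where $r(\mathfrak{g})$ is the maximal rank of the commutator matrix $\left(\sum_kC_{ij}^kz_k\right)_{1\le i,j\le n}$ over all points $z\in\mathfrak{g}^*$. The algebra $\mathfrak{d}_{2m}$ ($m\ge 3$) has basis $X_0,\dots,X_3,Y_1,\dots,Y_{2m-4},V_1,\dots,V_m$ and brackets $[X_0,X_i]=X_{i+1}$ ($i=1,2$); $[Y_{2i-1},Y_{2i}]=X_3$ ($1\le i\le m-2$); $[V_1,X_i]=(i+1)X_i$ ($0\le i\le 3$); $[V_1,Y_{2i-1}]=(i+4)Y_{2i-1}$, $[V_1,Y_{2i}]=-iY_{2i}$ ($1\le i\le m-2$);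 $[V_2,X_i]=X_i$ ($i=1,2,3$); $[V_2,Y_{2i}]=Y_{2i}$ ($1\le i\le m-2$); $[V_{i+2},Y_{2i-1}]=Y_{2i-1}$, $[V_{i+2},Y_{2i}]=-Y_{2i}$ ($1\le i\le m-2$). The algebra $\mathfrak{d}_{2m+1}$ ($m\ge 2$) has basis $X_0,\dots,X_3,Y_1,\dots,Y_{2m-3},V_1,\dots,V_m$ and brackets $[X_0,X_i]=X_{i+1}$ ($i=1,2$); $[X_1,Y_{2m-3}]=X_3$; $[Y_{2i-1},Y_{2i}]=X_3$ ($1\le i\le m-2$); $[V_1,X_i]=(i+1)X_i$ ($0\le i\le 3$); $[V_1,Y_{2i-1}]=(i+4)Y_{2i-1}$, $[V_1,Y_{2i}]=-iY_{2i}$ ($1\le i\le m-2$); $[V_1,Y_{2m-3}]=2Y_{2m-3}$; $[V_2,X_i]=X_i$ ($i=1,2,3$); $[V_2,Y_{2i}]=Y_{2i}$ ($1\le i\le m-2$); $[V_{i+2},Y_{2i-1}]=Y_{2i-1}$, $[V_{i+2},Y_{2i}]=-Y_{2i}$ ($1\le i\le m-2$). The algebra $\mathfrak{d}_5'$ has basis $X_0,\dots,X_3,Y_1,V_1,V_2$ and brackets $[X_0,X_i]=X_{i+1}$ ($i=1,2$); $[X_1,X_2]=Y_1$; $[V_1,X_i]=(i+1)X_i$ ($0\le i\le 3$), $[V_1,Y_1]=5Y_1$; $[V_2,X_i]=X_i$ ($i=1,2,3$), $[V_2,Y_1]=2Y_1$. *)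

theory Defs
  imports Complex_Main "Jordan_Normal_Form.DL_Rank"
begin

text \<open>A finite-dimensional complex Lie algebra is given by an ordered basis, whose members are
  identified with labels, and structure constants:
  the bracket of the basis elements \<open>a\<close> and \<open>b\<close> is the sum of \<open>sconst g a b k\<close> times \<open>k\<close>, with
  \<open>k\<close> ranging over the basis.\<close>

record 'b based_algebra =
  basis :: "'b list"
  sconst :: "'b \<Rightarrow> 'b \<Rightarrow> 'b \<Rightarrow> complex"

definition lie_algebra :: "'b based_algebra \<Rightarrow> bool" where
  "lie_algebra g \<longleftrightarrow>
     distinct (basis g) \<and>
     (\<forall>a\<in>set (basis g). \<forall>b\<in>set (basis g). \<forall>k. k \<notin> set (basis g) \<longrightarrow> sconst g a b k = 0) \<and>
     (\<forall>a\<in>set (basis g). \<forall>b\<in>set (basis g). \<forall>k\<in>set (basis g).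
        sconst g a b k = - sconst g b a k) \<and>
     (\<forall>a\<in>set (basis g). \<forall>b\<in>set (basis g). \<forall>c\<in>set (basis g). \<forall>k\<in>set (basis g).
        (\<Sum>l\<in>set (basis g). sconst g a b l * sconst g l c k
           + sconst g b c l * sconst g l a k + sconst g c a l * sconst g l b k) = 0)"

definition lie_dim :: "'b based_algebra \<Rightarrow> nat" where
  "lie_dim g = length (basis g)"

text \<open>A point of the dual space is represented by its coordinates with respect to the dual basis.\<close>

definition commutator_mat :: "'b based_algebra \<Rightarrow> complex vec \<Rightarrow> complex mat" where
  "commutator_mat g z = mat (lie_dim g) (lie_dim g)
     (\<lambda>(i, j). \<Sum>k<lie_dim g. sconst g (basis g ! i) (basis g ! j) (basis g ! k) * z $ k)"

definition max_rank :: "'b based_algebra \<Rightarrow> nat" where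
  "max_rank g =
     Max {vec_space.rank (lie_dim g) (commutator_mat g z) |z. z \<in> carrier_vec (lie_dim g)}"

text \<open>The number of functionally independent invariants of the coadjoint representation, by the
  Beltrametti--Blasi formula.  The subtraction never truncates, since the rank of a matrix is
  bounded by its number of columns.\<close>

definition num_invariants :: "'b based_algebra \<Rightarrow> nat" where
  "num_invariants g = lie_dim g - max_rank g"

text \<open>An entry \<open>(p, q, c, r)\<close> of a bracket table stands for \<open>[p, q] = c r\<close>.  Each bracket is
  written in one order only; the other order follows by antisymmetry, and brackets without an
  entry are zero.\<close>

definition lie_of_table :: "'b list \<Rightarrow> ('b \<times> 'b \<times> complex \<times> 'b) list \<Rightarrow> 'b based_algebra" where
  "lie_of_table bs tbl = \<lparr>basis = bs, sconst = (\<lambda>a b k.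
     (\<Sum>(p, q, c, r)\<leftarrow>tbl. (if p = a \<and> q = b \<and> r = k then c else 0)
                         - (if p = b \<and> q = a \<and> r = k then c else 0)))\<rparr>"

text \<open>Below, \<open>d_even m\<close> is the algebra with index \<open>2m\<close>, for \<open>m \<ge> 3\<close>, and \<open>d_odd m\<close> the one with index
  \<open>2m + 1\<close>, for \<open>m \<ge> 2\<close>; the index is the dimension of the span of the \<open>X\<close> and \<open>Y\<close>.\<close>

datatype gen = X nat | Y nat | V nat

definition d_even_table :: "nat \<Rightarrow> (gen \<times> gen \<times> complex \<times> gen) list" where
  "d_even_table m =
     [(X 0, X i, 1, X (i + 1)). i \<leftarrow> [1..<3]] @
     [(Y (2 * i - 1), Y (2 * i), 1, X 3). i \<leftarrow> [1..<m - 1]] @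
     [(V 1, X i, of_nat i + 1, X i). i \<leftarrow> [0..<4]] @
     [(V 1, Y (2 * i - 1), of_nat i + 4, Y (2 * i - 1)). i \<leftarrow> [1..<m - 1]] @
     [(V 1, Y (2 * i), - of_nat i, Y (2 * i)). i \<leftarrow> [1..<m - 1]] @
     [(V 2, X i, 1, X i). i \<leftarrow> [1..<4]] @
     [(V 2, Y (2 * i), 1, Y (2 * i)). i \<leftarrow> [1..<m - 1]] @
     [(V (i + 2), Y (2 * i - 1), 1, Y (2 * i - 1)). i \<leftarrow> [1..<m - 1]] @
     [(V (i + 2), Y (2 * i), -1, Y (2 * i)). i \<leftarrow> [1..<m - 1]]"

definition d_even :: "nat \<Rightarrow> gen based_algebra" where
  "d_even m = lie_of_table (map X [0..<4] @ map Y [1..<2 * m - 3] @ map V [1..<m + 1])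
     (d_even_table m)"

definition d_odd_table :: "nat \<Rightarrow> (gen \<times> gen \<times> complex \<times> gen) list" where
  "d_odd_table m =
     [(X 0, X i, 1, X (i + 1)). i \<leftarrow> [1..<3]] @
     [(X 1, Y (2 * m - 3), 1, X 3)] @
     [(Y (2 * i - 1), Y (2 * i), 1, X 3). i \<leftarrow> [1..<m - 1]] @
     [(V 1, X i, of_nat i + 1, X i). i \<leftarrow> [0..<4]] @
     [(V 1, Y (2 * i - 1), of_nat i + 4, Y (2 * i - 1)). i \<leftarrow> [1..<m - 1]] @
     [(V 1, Y (2 * i), - of_nat i, Y (2 * i)). i \<leftarrow> [1..<m - 1]] @
     [(V 1, Y (2 * m - 3), 2, Y (2 * m - 3))] @
     [(V 2, X i, 1, X i). i \<leftarrow> [1..<4]] @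
     [(V 2, Y (2 * i), 1, Y (2 * i)). i \<leftarrow> [1..<m - 1]] @
     [(V (i + 2), Y (2 * i - 1), 1, Y (2 * i - 1)). i \<leftarrow> [1..<m - 1]] @
     [(V (i + 2), Y (2 * i), -1, Y (2 * i)). i \<leftarrow> [1..<m - 1]]"

definition d_odd :: "nat \<Rightarrow> gen based_algebra" where
  "d_odd m = lie_of_table (map X [0..<4] @ map Y [1..<2 * m - 2] @ map V [1..<m + 1])
     (d_odd_table m)"

definition d5'_table :: "(gen \<times> gen \<times> complex \<times> gen) list" where
  "d5'_table =
     [(X 0, X i, 1, X (i + 1)). i \<leftarrow> [1..<3]] @
     [(X 1, X 2, 1, Y 1)] @
     [(V 1, X i, of_nat i + 1, X i). i \<leftarrow> [0..<4]] @
     [(V 1, Y 1, 5, Y 1)] @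
     [(V 2, X i, 1, X i). i \<leftarrow> [1..<4]] @
     [(V 2, Y 1, 2, Y 1)]"

definition d5' :: "gen based_algebra" where
  "d5' = lie_of_table (map X [0..<4] @ [Y 1] @ map V [1..<3]) d5'_table"

lemma basis_lie_of_table : "basis (lie_of_table bs tbl) = bs"
  by (simp add: lie_of_table_def)

lemma sconst_antisym: "sconst (lie_of_table bs tbl) a b k = - sconst (lie_of_table bs tbl) b a k"
  unfolding lie_of_table_def by (induction tbl) (auto split: prod.splits)

lemma sconst_nonzeroD:
  assumes "sconst (lie_of_table bs tbl) a b k \<noteq> 0"
  obtains c where "(a, b, c, k) \<in> set tbl" | c where "(b, a, c, k) \<in> set tbl"
proof -
  have "\<exists>x\<in>set tbl. (case x of (p, q, c, r) \<Rightarrow> (if p = a \<and> q = b \<and> r = k then c else 0)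
      - (if p = b \<and> q = a \<and> r = k then c else 0)) \<noteq> 0"
  proof (rule ccontr)
    assume "\<not> ?thesis"
    then have "map (\<lambda>(p, q, c, r). (if p = a \<and> q = b \<and> r = k then c else 0)
      - (if p = b \<and> q = a \<and> r = k then c else 0)) tbl = map (\<lambda>_. 0) tbl"
      by (intro map_cong refl) blast
    then show False
      using assms by (simp add: lie_of_table_def del: map_eq_conv)
  qed
  then obtain p q c r where "(p, q, c, r) \<in> set tbl"
    and "(if p = a \<and> q = b \<and> r = k then c else 0)
      - (if p = b \<and> q = a \<and> r = k then c else 0) \<noteq> 0"
    by (metis (no_types, lifting) prod_cases4 case_prod_conv)
  then show thesis using that by (cases "p = a \<and> q = b \<and> r = k") (auto split: if_splits)
qed

text \<open>\<open>V\<close> acts diagonally on the \<open>X\<close> and \<open>Y\<close> with weights that are additive along their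
  brackets, and the only bracket of two \<open>X\<close> or \<open>Y\<close> that is not central among them is
  \<open>[p, q] = u\<close>, where \<open>u\<close> brackets nontrivially with \<open>p\<close> and \<open>q\<close> only.\<close>

lemma lie_algebra_of_weights:
  fixes bs :: "'b list" and tbl p q u
  defines "C \<equiv> sconst (lie_of_table bs tbl)"
  assumes dist: "distinct bs" and B: "set bs = N \<union> T"
    and closed: "\<And>p q c r. (p, q, c, r) \<in> set tbl \<Longrightarrow> r \<in> N"
    and TT: "\<And>s t k. s \<in> T \<Longrightarrow> t \<in> T \<Longrightarrow> C s t k = 0"
    and TN: "\<And>t b k. t \<in> T \<Longrightarrow> k \<noteq> b \<Longrightarrow> C t b k = 0"
    and wt: "\<And>t a b k. t \<in> T \<Longrightarrow> a \<in> N \<Longrightarrow> b \<in> N \<Longrightarrow> C a b k \<noteq> 0 \<Longrightarrow>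
               C t a a + C t b b = C t k k"
    and u: "u \<in> set bs"
    and cen: "\<And>a b c l k. a \<in> N \<Longrightarrow> b \<in> N \<Longrightarrow> c \<in> N \<Longrightarrow> C a b l \<noteq> 0 \<Longrightarrow> l \<noteq> u \<Longrightarrow>
               C l c k = 0"
    and pq: "\<And>a b. a \<in> N \<Longrightarrow> b \<in> N \<Longrightarrow> C a b u \<noteq> 0 \<Longrightarrow> a \<in> {p, q} \<and> b \<in> {p, q}"
    and upq: "\<And>c k. c \<in> N \<Longrightarrow> C u c k \<noteq> 0 \<Longrightarrow> c \<in> {p, q}"
  shows "lie_algebra (lie_of_table bs tbl)"
proof -
  define J where "J a b c k =
    (\<Sum>l\<in>set bs. C a b l * C l c k + C b c l * C l a k + C c a l * C l b k)" for a b c k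
  have anti: "C a b k = - C b a k" for a b k
    unfolding C_def by (rule sconst_antisym)
  have out: "C a b k = 0" if "k \<notin> set bs" for a b k
  proof (rule ccontr)
    assume "C a b k \<noteq> 0"
    then show False
      unfolding C_def by (rule sconst_nonzeroD) (use closed B that in blast)+
  qed
  have rot: "J a b c k = J b c a k" for a b c k
    unfolding J_def by (rule sum.cong) (simp_all add: add_ac)
  have sumT: "(\<Sum>l\<in>set bs. C t a l * f l) = C t a a * f a"
    if "t \<in> T" "a \<in> set bs" for t a f
  proof -
    have "(\<Sum>l\<in>set bs. C t a l * f l) = (\<Sum>l\<in>set bs. if l = a then C t a a * f a else 0)"
      by (rule sum.cong) (use TN[OF that(1)] in auto)
    then show ?thesis using that by simp
  qed
  have Teq: "C t a k = (if k = a then C t a a else 0)" if "t \<in> T" for t a k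
    using TN[OF that] by auto
  have one: "J t a b k = 0" if t: "t \<in> T" and ab: "a \<in> set bs" "b \<in> set bs" for t a b k
  proof -
    have "(\<Sum>l\<in>set bs. C a b l * C l t k) = - (\<Sum>l\<in>set bs. if l = k then C a b k * C t k k else 0)"
      unfolding sum_negf[symmetric]
    proof (rule sum.cong[OF refl])
      fix l
      have "C l t k = - (if k = l then C t l l else 0)"
        using anti[of l t k] Teq[OF t, of l k] by argo
      then show "C a b l * C l t k = - (if l = k then C a b k * C t k k else 0)"
        by (cases "l = k") simp_all
    qed
    also have "\<dots> = - (C a b k * C t k k)"
    proof (cases "k \<in> set bs")
      case False
      then show ?thesis by (simp add: out)
    qed simp
    finally have 2: "(\<Sum>l\<in>set bs. C a b l * C l t k) = - (C a b k * C t k k)" .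
    have 1: "(\<Sum>l\<in>set bs. C t a l * C l b k) = C t a a * C a b k"
      by (rule sumT[OF t ab(1)])
    have "(\<Sum>l\<in>set bs. C b t l * C l a k) = - (\<Sum>l\<in>set bs. C t b l * C l a k)"
      unfolding sum_negf[symmetric]
      by (rule sum.cong[OF refl]) (metis anti mult_minus_left)
    also have "\<dots> = C t b b * C a b k"
      unfolding sumT[OF t ab(2)] by (subst anti[of b a]) simp
    finally have 3: "(\<Sum>l\<in>set bs. C b t l * C l a k) = C t b b * C a b k" .
    have eq: "J t a b k = (C t a a + C t b b - C t k k) * C a b k"
      unfolding J_def sum.distrib 1 2 3 by (simp add: algebra_simps)
    have "C a b k = 0 \<or> C t a a + C t b b = C t k k"
    proof (cases "a \<in> T \<or> b \<in> T")
      case True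
      then show ?thesis
      proof
        assume "a \<in> T" then show ?thesis using TT[OF t, of a a] TN[of a k b] by (cases "k = b") auto
      next
        assume "b \<in> T"
        then show ?thesis using TT[OF t, of b b] TN[of b k a] anti[of a b k]
          by (cases "k = a") auto
      qed
    next
      case False
      then show ?thesis using wt[OF t, of a b k] ab B by blast
    qed
    then show ?thesis unfolding eq by auto
  qed
  have J0: "J a b c k = 0" if "a \<in> set bs" "b \<in> set bs" "c \<in> set bs" for a b c k
  proof (cases "a \<in> T \<or> b \<in> T \<or> c \<in> T")
    case True
    then show ?thesis using one[of a b c k] one[of b c a k] one[of c a b k] that rot[of a b c k] rot[of b c a k]
      by auto
  next
    case False
    then have N: "a \<in> N" "b \<in> N" "c \<in> N" using that B by auto
    have red: "(\<Sum>l\<in>set bs. C a' b' l * C l c' k) = C a' b' u * C u c' k"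
      if "a' \<in> N" "b' \<in> N" "c' \<in> N" for a' b' c'
    proof -
      have "(\<Sum>l\<in>set bs. C a' b' l * C l c' k)
          = (\<Sum>l\<in>set bs. if l = u then C a' b' u * C u c' k else 0)"
        by (rule sum.cong) (use cen[OF that] in auto)
      then show ?thesis using u by simp
    qed
    have J: "J a b c k = C a b u * C u c k + C b c u * C u a k + C c a u * C u b k"
      unfolding J_def sum.distrib by (simp only: red N)
    have nil: "C x x k = 0" for x k
      using anti[of x x k] by simp
    show ?thesis
    proof (cases "a \<in> {p, q} \<and> b \<in> {p, q} \<and> c \<in> {p, q}")
      case True
      then show ?thesis
        unfolding J using anti[of q p u] by (auto simp: nil)
    next
      case False
      then have "C a b u = 0 \<or> C u c k = 0" "C b c u = 0 \<or> C u a k = 0"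
        "C c a u = 0 \<or> C u b k = 0"
        using pq[OF N(1,2)] pq[OF N(2,3)] pq[OF N(3,1)] upq[OF N(1)] upq[OF N(2)] upq[OF N(3)]
        by blast+
      then show ?thesis
        unfolding J by auto
    qed
  qed
  show ?thesis
    unfolding lie_algebra_def basis_lie_of_table C_def[symmetric] J_def[symmetric]
  proof (intro conjI ballI allI impI)
    show "distinct bs" by (rule dist)
  next
    fix a b k assume "k \<notin> set bs"
    then show "C a b k = 0" by (rule out)
  next
    fix a b k
    show "C a b k = - C b a k" by (rule anti)
  next
    fix a b c k assume "a \<in> set bs" "b \<in> set bs" "c \<in> set bs"
    then show "J a b c k = 0" by (rule J0)
  qed
qed

lemma lie_algebra_of_table:
  fixes bs :: "'b list" and tbl p q u S
  defines "C \<equiv> sconst (lie_of_table bs tbl)"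
  assumes dist: "distinct bs" and B: "set bs = N \<union> T" and disj: "N \<inter> T = {}"
    and entry: "\<And>a b c k. (a, b, c, k) \<in> set tbl \<Longrightarrow>
                  a \<in> T \<and> b \<in> N \<and> k = b \<or> (a, b, k) \<in> S"
    and S: "S \<subseteq> N \<times> N \<times> N"
    and wt: "\<And>t a b k. t \<in> T \<Longrightarrow> (a, b, k) \<in> S \<Longrightarrow> C t a a + C t b b = C t k k"
    and u: "u \<in> N"
    and cen: "\<And>a b k a' b' k'. (a, b, k) \<in> S \<Longrightarrow> k \<noteq> u \<Longrightarrow> (a', b', k') \<in> S \<Longrightarrow>
                a' \<noteq> k \<and> b' \<noteq> k"
    and pq: "\<And>a b. (a, b, u) \<in> S \<Longrightarrow> a \<in> {p, q} \<and> b \<in> {p, q}"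
    and upq: "\<And>a b k. (a, b, k) \<in> S \<Longrightarrow> (a = u \<longrightarrow> b \<in> {p, q}) \<and> (b = u \<longrightarrow> a \<in> {p, q})"
  shows "lie_algebra (lie_of_table bs tbl)"
proof -
  have nz: "a \<in> T \<and> b \<in> N \<and> k = b \<or> b \<in> T \<and> a \<in> N \<and> k = a \<or> (a, b, k) \<in> S \<or> (b, a, k) \<in> S"
    if "C a b k \<noteq> 0" for a b k
    using that unfolding C_def by (rule sconst_nonzeroD) (use entry in blast)+
  have nzN: "(a, b, k) \<in> S \<or> (b, a, k) \<in> S" if "C a b k \<noteq> 0" "a \<in> N" "b \<in> N" for a b k
    using nz[OF that(1)] that disj by blast
  have SN: "a \<in> N" "b \<in> N" "k \<in> N" if "(a, b, k) \<in> S" for a b k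
    using S that by auto
  show ?thesis
  proof (rule lie_algebra_of_weights[where N = N and T = T and p = p and q = q and u = u])
    show "distinct bs" "set bs = N \<union> T" "u \<in> set bs" using dist B u by auto
  next
    fix a b c k assume "(a, b, c, k) \<in> set tbl"
    then show "k \<in> N" using entry SN by blast
  next
    fix s t k assume "s \<in> T" "t \<in> T"
    then have "C s t k = 0" using nz[of s t k] disj SN by blast
    then show "sconst (lie_of_table bs tbl) s t k = 0" unfolding C_def .
  next
    fix t b k :: 'b assume "t \<in> T" "k \<noteq> b"
    then have "C t b k = 0" using nz[of t b k] disj SN by blast
    then show "sconst (lie_of_table bs tbl) t b k = 0" unfolding C_def .
  next
    fix t a b k
    assume "t \<in> T" "a \<in> N" "b \<in> N" "sconst (lie_of_table bs tbl) a b k \<noteq> 0"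
    then have "C t a a + C t b b = C t k k"
      using nzN[of a b k] wt[of t a b k] wt[of t b a k] unfolding C_def by (auto simp: add.commute)
    then show "sconst (lie_of_table bs tbl) t a a + sconst (lie_of_table bs tbl) t b b
        = sconst (lie_of_table bs tbl) t k k" unfolding C_def .
  next
    fix a b c l k
    assume "a \<in> N" "b \<in> N" "c \<in> N" "sconst (lie_of_table bs tbl) a b l \<noteq> 0" "l \<noteq> u"
    then have "C l c k = 0"
      using nzN[of a b l] nzN[of l c k] cen SN unfolding C_def by metis
    then show "sconst (lie_of_table bs tbl) l c k = 0" unfolding C_def .
  next
    fix a b assume "a \<in> N" "b \<in> N" "sconst (lie_of_table bs tbl) a b u \<noteq> 0"
    then show "a \<in> {p, q} \<and> b \<in> {p, q}"
      using nzN[of a b u] pq unfolding C_def by blast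
  next
    fix c k assume c: "c \<in> N" "sconst (lie_of_table bs tbl) u c k \<noteq> 0"
    have "(u, c, k) \<in> S \<or> (c, u, k) \<in> S"
      using nzN[of u c k] c u unfolding C_def by blast
    then show "c \<in> {p, q}" using upq by blast
  qed
qed

lemma sconst_eq_sum_list:
  "sconst (lie_of_table bs tbl) a b k =
     (\<Sum>(p, q, c, r)\<leftarrow>tbl. (if p = a \<and> q = b \<and> r = k then c else 0)
                         - (if p = b \<and> q = a \<and> r = k then c else 0))"
  by (simp add: lie_of_table_def)

lemma sum_list_upt: "(\<Sum>i\<leftarrow>[a..<b]. f i) = (\<Sum>i\<in>{a..<b}. f i)" for f :: "nat \<Rightarrow> complex"
  by (simp add: interv_sum_list_conv_sum_set_nat)

lemma parity:
  assumes "Suc 0 \<le> i"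
  shows "2 * x = 2 * i - Suc 0 \<longleftrightarrow> False" and "2 * x - Suc 0 = 2 * i \<longleftrightarrow> False"
    and "2 * x - Suc 0 = 2 * i - Suc 0 \<longleftrightarrow> x = i"
  using assms by presburger+

lemma d_even_weights:
  shows "sconst (d_even m) (V 1) (X i) (X i) = (if i < 4 then of_nat i + 1 else 0)"
    and "sconst (d_even m) (V 2) (X i) (X i) = (if 1 \<le> i \<and> i < 4 then 1 else 0)"
    and "j \<ge> 3 \<Longrightarrow> sconst (d_even m) (V j) (X i) (X i) = 0"
    and "1 \<le> i \<Longrightarrow> i < m - 1 \<Longrightarrow>
      sconst (d_even m) (V 1) (Y (2 * i - 1)) (Y (2 * i - 1)) = of_nat i + 4"
    and "1 \<le> i \<Longrightarrow> i < m - 1 \<Longrightarrow> sconst (d_even m) (V 1) (Y (2 * i)) (Y (2 * i)) = - of_nat i"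
    and "1 \<le> i \<Longrightarrow> i < m - 1 \<Longrightarrow> sconst (d_even m) (V 2) (Y (2 * i - 1)) (Y (2 * i - 1)) = 0"
    and "1 \<le> i \<Longrightarrow> i < m - 1 \<Longrightarrow> sconst (d_even m) (V 2) (Y (2 * i)) (Y (2 * i)) = 1"
    and "1 \<le> i \<Longrightarrow> i < m - 1 \<Longrightarrow> j \<ge> 3 \<Longrightarrow>
      sconst (d_even m) (V j) (Y (2 * i - 1)) (Y (2 * i - 1)) = (if j = i + 2 then 1 else 0)"
    and "1 \<le> i \<Longrightarrow> i < m - 1 \<Longrightarrow> j \<ge> 3 \<Longrightarrow>
      sconst (d_even m) (V j) (Y (2 * i)) (Y (2 * i)) = (if j = i + 2 then -1 else 0)"
  unfolding d_even_def sconst_eq_sum_list d_even_table_def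
  by (auto simp: o_def sum_list_upt parity cong: conj_cong intro!: sum.neutral)

lemma upts: "[0..<4] = [0, 1, 2, 3 :: nat]" "[1..<3] = [1, 2 :: nat]" "[1..<4] = [1, 2, 3 :: nat]"
  by (simp_all add: upt_conv_Cons)

lemma lie_algebra_d_even:
  assumes m: "m \<ge> 3"
  shows "lie_algebra (d_even m)"
proof -
  let ?B = "map X [0..<4] @ map Y [1..<2 * m - 3] @ map V [1..<m + 1]"
  let ?N = "X ` {0..<4} \<union> Y ` {1..<2 * m - 3}" and ?T = "V ` {1..<m + 1}"
  let ?S = "{(X 0, X 1, X 2), (X 0, X 2, X 3)} \<union>
      (\<lambda>i. (Y (2 * i - 1), Y (2 * i), X 3)) ` {1..<m - 1}"
  show ?thesis
    unfolding d_even_def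
  proof (rule lie_algebra_of_table[where N = "?N" and T = "?T"
        and p = "X 0" and q = "X 1" and u = "X 2"
        and S = "?S"], unfold d_even_def[symmetric])
    show "distinct ?B"
      by (auto simp: distinct_map inj_on_def)
    show "set ?B = ?N \<union> ?T"
      by auto
  next
    fix a b c k assume "(a, b, c, k) \<in> set (d_even_table m)"
    then show "a \<in> ?T \<and> b \<in> ?N \<and> k = b \<or> (a, b, k) \<in> ?S"
      unfolding d_even_table_def upts set_append Un_iff list.map list.set set_map set_upt
      using m
      by (elim disjE imageE insertE emptyE) (simp_all add: image_iff parity, arith+)
  next
    fix t a b k assume t: "t \<in> ?T" and abk: "(a, b, k) \<in> ?S"
    from t obtain j where j: "t = V j" "j = 1 \<or> j = 2 \<or> j \<ge> 3" by force
    from abk show "sconst (d_even m) t a a + sconst (d_even m) t b b = sconst (d_even m) t k k"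
      using j(2) m unfolding j(1) Un_iff insert_iff
      by (elim disjE imageE) (simp_all add: d_even_weights[unfolded One_nat_def])
  next
    have "Y (2 * i - 1) \<in> ?N" if "i \<in> {1..<m - 1}" for i
      by (rule UnI2, rule imageI) (use that in auto)
    moreover have "Y (2 * i) \<in> ?N" if "i \<in> {1..<m - 1}" for i
      by (rule UnI2, rule imageI) (use that in auto)
    ultimately show "?S \<subseteq> ?N \<times> ?N \<times> ?N"
      by (simp add: image_subset_iff)
  qed (use m in auto)
qed

lemma parity_last:
  fixes m x :: nat
  assumes "2 \<le> m"
  shows "2 * m - 3 = 2 * x \<longleftrightarrow> False" and "2 * x = 2 * m - 3 \<longleftrightarrow> False"
    and "2 * m - 3 = 2 * x - Suc 0 \<longleftrightarrow> x = m - Suc 0"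
    and "2 * x - Suc 0 = 2 * m - 3 \<longleftrightarrow> x = m - Suc 0"
  using assms by presburger+

lemma d_odd_weights:
  shows "sconst (d_odd m) (V 1) (X i) (X i) = (if i < 4 then of_nat i + 1 else 0)"
    and "sconst (d_odd m) (V 2) (X i) (X i) = (if 1 \<le> i \<and> i < 4 then 1 else 0)"
    and "j \<ge> 3 \<Longrightarrow> sconst (d_odd m) (V j) (X i) (X i) = 0"
    and "m \<ge> 2 \<Longrightarrow> 1 \<le> i \<Longrightarrow> i < m - 1 \<Longrightarrow>
      sconst (d_odd m) (V 1) (Y (2 * i - 1)) (Y (2 * i - 1)) = of_nat i + 4"
    and "m \<ge> 2 \<Longrightarrow> 1 \<le> i \<Longrightarrow> i < m - 1 \<Longrightarrow> sconst (d_odd m) (V 1) (Y (2 * i)) (Y (2 * i)) = - of_nat i"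
    and "m \<ge> 2 \<Longrightarrow> 1 \<le> i \<Longrightarrow> i < m - 1 \<Longrightarrow> sconst (d_odd m) (V 2) (Y (2 * i - 1)) (Y (2 * i - 1)) = 0"
    and "m \<ge> 2 \<Longrightarrow> 1 \<le> i \<Longrightarrow> i < m - 1 \<Longrightarrow> sconst (d_odd m) (V 2) (Y (2 * i)) (Y (2 * i)) = 1"
    and "m \<ge> 2 \<Longrightarrow> 1 \<le> i \<Longrightarrow> i < m - 1 \<Longrightarrow> j \<ge> 3 \<Longrightarrow>
      sconst (d_odd m) (V j) (Y (2 * i - 1)) (Y (2 * i - 1)) = (if j = i + 2 then 1 else 0)"
    and "m \<ge> 2 \<Longrightarrow> 1 \<le> i \<Longrightarrow> i < m - 1 \<Longrightarrow> j \<ge> 3 \<Longrightarrow>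
      sconst (d_odd m) (V j) (Y (2 * i)) (Y (2 * i)) = (if j = i + 2 then -1 else 0)"
    and "m \<ge> 2 \<Longrightarrow> sconst (d_odd m) (V 1) (Y (2 * m - 3)) (Y (2 * m - 3)) = 2"
    and "m \<ge> 2 \<Longrightarrow> j \<ge> 2 \<Longrightarrow> sconst (d_odd m) (V j) (Y (2 * m - 3)) (Y (2 * m - 3)) = 0"
  unfolding d_odd_def sconst_eq_sum_list d_odd_table_def
  by (auto simp: parity_last o_def sum_list_upt parity cong: conj_cong intro!: sum.neutral)

lemma lie_algebra_d_odd:
  assumes m: "m \<ge> 2"
  shows "lie_algebra (d_odd m)"
proof -
  let ?B = "map X [0..<4] @ map Y [1..<2 * m - 2] @ map V [1..<m + 1]"
  let ?N = "X ` {0..<4} \<union> Y ` {1..<2 * m - 2}" and ?T = "V ` {1..<m + 1}"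
  let ?S = "{(X 0, X 1, X 2), (X 0, X 2, X 3), (X 1, Y (2 * m - 3), X 3)} \<union>
      (\<lambda>i. (Y (2 * i - 1), Y (2 * i), X 3)) ` {1..<m - 1}"
  show ?thesis
    unfolding d_odd_def
  proof (rule lie_algebra_of_table[where N = "?N" and T = "?T"
        and p = "X 0" and q = "X 1" and u = "X 2"
        and S = "?S"], unfold d_odd_def[symmetric])
    show "distinct ?B"
      by (auto simp: distinct_map inj_on_def)
    show "set ?B = ?N \<union> ?T"
      by auto
  next
    fix a b c k assume "(a, b, c, k) \<in> set (d_odd_table m)"
    then show "a \<in> ?T \<and> b \<in> ?N \<and> k = b \<or> (a, b, k) \<in> ?S"
      unfolding d_odd_table_def upts set_append Un_iff list.map list.set set_map set_upt
      using m
      by (elim disjE imageE insertE emptyE) (simp_all add: image_iff parity, arith+)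
  next
    fix t a b k assume t: "t \<in> ?T" and abk: "(a, b, k) \<in> ?S"
    from t obtain j where j: "t = V j" "j = 1 \<or> j = 2 \<or> j \<ge> 3" by force
    from abk show "sconst (d_odd m) t a a + sconst (d_odd m) t b b = sconst (d_odd m) t k k"
      using j(2) m unfolding j(1) Un_iff insert_iff
      by (elim disjE imageE) (simp_all add: d_odd_weights[unfolded One_nat_def])
  next
    have "Y (2 * i - 1) \<in> ?N" if "i \<in> {1..<m - 1}" for i
      by (rule UnI2, rule imageI) (use that in auto)
    moreover have "Y (2 * i) \<in> ?N" if "i \<in> {1..<m - 1}" for i
      by (rule UnI2, rule imageI) (use that in auto)
    moreover have "Y (2 * m - 3) \<in> ?N"
      by (rule UnI2, rule imageI) (use m in auto)
    ultimately show "?S \<subseteq> ?N \<times> ?N \<times> ?N"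
      by (simp add: image_subset_iff)
  qed (use m in auto)
qed

lemma d5'_weights:
  shows "sconst d5' (V 1) (X i) (X i) = (if i < 4 then of_nat i + 1 else 0)"
    and "sconst d5' (V 2) (X i) (X i) = (if 1 \<le> i \<and> i < 4 then 1 else 0)"
    and "sconst d5' (V 1) (Y 1) (Y 1) = 5"
    and "sconst d5' (V 2) (Y 1) (Y 1) = 2"
  unfolding d5'_def sconst_eq_sum_list d5'_table_def
  by (auto simp: o_def sum_list_upt intro!: sum.neutral)

lemma lie_algebra_d5':
  shows "lie_algebra d5'"
proof -
  let ?B = "map X [0..<4] @ [Y 1] @ map V [1..<3]"
  let ?N = "X ` {0..<4} \<union> {Y 1}" and ?T = "V ` {1..<3}"
  let ?S = "{(X 0, X 1, X 2), (X 0, X 2, X 3), (X 1, X 2, Y 1)}"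
  show ?thesis
    unfolding d5'_def
  proof (rule lie_algebra_of_table[where N = "?N" and T = "?T"
        and p = "X 0" and q = "X 1" and u = "X 2"
        and S = "?S"], unfold d5'_def[symmetric])
    show "distinct ?B"
      by (auto simp: distinct_map inj_on_def)
    show "set ?B = ?N \<union> ?T"
      by auto
  next
    fix a b c k assume "(a, b, c, k) \<in> set d5'_table"
    then show "a \<in> ?T \<and> b \<in> ?N \<and> k = b \<or> (a, b, k) \<in> ?S"
      unfolding d5'_table_def upts set_append Un_iff list.map list.set set_map set_upt
      by (elim disjE imageE insertE emptyE) (simp_all add: image_iff)
  next
    fix t a b k assume t: "t \<in> ?T" and abk: "(a, b, k) \<in> ?S"
    from t obtain j where j: "t = V j" "j = 1 \<or> j = 2" by force
    from abk show "sconst d5' t a a + sconst d5' t b b = sconst d5' t k k"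
      using j(2) unfolding j(1) Un_iff insert_iff
      by (elim disjE imageE) (simp_all add: d5'_weights[unfolded One_nat_def])
  qed auto
qed

end

theory Submission
  imports Defs
begin

text \<open>At a point \<open>\<zeta>\<close> of the dual space the commutator matrix is the Gram matrix of the 2-form
  that sums \<open>c \<cdot> \<zeta>(r) \<cdot> p* \<and> q*\<close> over the entries \<open>[p, q] = c r\<close> of the bracket table, and a sum of \<open>N\<close>
  wedges of linear forms has rank at most \<open>2 N\<close>.  All 2-forms \<open>x p* \<and> q* + v \<and> (y p* + z q*)\<close> are
  decomposable.  Hence each pair \<open>Y (2i - 1), Y (2i)\<close> together with \<open>V (i + 2)\<close> contributes a
  single wedge, and \<open>m + 1\<close> wedges are enough at every point, generic or not.  At a suitable sparse point the
  columns of a set of \<open>2 (m + 1)\<close> basis elements are independent, so the bound is attained.  The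
  seven-dimensional algebra is treated in the same way with three wedges.\<close>

section \<open>Linear forms, wedges and the 2-form of a bracket table\<close>

definition coord :: "'b \<Rightarrow> 'b \<Rightarrow> complex" where
  "coord p a = of_bool (p = a)"

text \<open>Linear forms are represented by their values on the basis labels, so this is the Gram
  matrix of an exterior product.\<close>

definition wedge :: "('b \<Rightarrow> complex) \<Rightarrow> ('b \<Rightarrow> complex) \<Rightarrow> 'b \<Rightarrow> 'b \<Rightarrow> complex" where
  "wedge f g a b = f a * g b - f b * g a"

text \<open>\<open>F\<close> stays arbitrary because each expansion is used twice: with
  \<open>wedge (coord p) (coord q) a b\<close> it yields an entry of the commutator matrix, with the
  contraction of that wedge by a vector it yields an equation for the kernel.\<close>

definition table_sum ::
  "('b \<times> 'b \<times> complex \<times> 'b) list \<Rightarrow> ('b \<Rightarrow> complex) \<Rightarrow> ('b \<Rightarrow> 'b \<Rightarrow> complex) \<Rightarrow> complex" where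
  "table_sum tbl \<zeta> F = (\<Sum>(p, q, c, r)\<leftarrow>tbl. c * \<zeta> r * F p q)"

lemma wedge_add_right: "wedge f (\<lambda>b. g b + h b) a b = wedge f g a b + wedge f h a b"
  by (simp add: wedge_def algebra_simps)

lemma wedge_sum_right: "wedge f (\<lambda>b. \<Sum>i\<in>I. g i b) a b = (\<Sum>i\<in>I. wedge f (g i) a b)"
  by (simp add: wedge_def sum_distrib_left sum_distrib_right sum_subtractf)

lemma sum_table_sum:
  "(\<Sum>b\<in>S. table_sum tbl \<zeta> (\<lambda>p q. F p q b)) = table_sum tbl \<zeta> (\<lambda>p q. \<Sum>b\<in>S. F p q b)"
  by (induction tbl) (auto simp: table_sum_def sum.distrib sum_distrib_left)

lemma table_sum_mult_right:
  "table_sum tbl \<zeta> F * y = table_sum tbl \<zeta> (\<lambda>p q. F p q * y)"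
  by (induction tbl) (auto simp: table_sum_def algebra_simps)

subsection \<open>Rank bounds\<close>

text \<open>This form reduces a lower bound on the rank to solving a homogeneous linear system whose
  unknowns are supported on \<open>J\<close>.\<close>

lemma (in vec_space) rank_ge_card_cols:
  assumes A: "A \<in> carrier_mat n nc" and J: "J \<subseteq> {..<nc}"
    and inj: "\<And>c j. (\<And>i. i < n \<Longrightarrow> (\<Sum>j\<in>J. A $$ (i, j) * c j) = 0) \<Longrightarrow> j \<in> J \<Longrightarrow> c j = 0"
  shows "card J \<le> rank A"
proof -
  have fin: "finite J" using J finite_subset by blast
  let ?U = "col A ` J"
  have idx: "col A j $ i = A $$ (i, j)" if "i < n" "j \<in> J" for i j
    using A J that by auto
  \<comment> \<open>\<open>lin_indpt\<close> speaks of a set of vectors, in which equal columns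
    would merge. Two equal columns are excluded by the coefficients 1 at \<open>x\<close> and -1 at
    \<open>y\<close>.\<close>
  have inj_col: "inj_on (col A) J"
  proof (rule inj_onI, rule ccontr)
    fix x y assume xy: "x \<in> J" "y \<in> J" "col A x = col A y" "x \<noteq> y"
    let ?c = "\<lambda>j. of_bool (j = x) - of_bool (j = y) :: 'a"
    have "?c x = 0"
    proof (rule inj[of ?c x, OF _ xy(1)])
      fix i assume i: "i < n"
      have "(\<Sum>j\<in>J. A $$ (i, j) * ?c j)
          = (\<Sum>j\<in>J. (if j = x then A $$ (i, x) else 0) - (if j = y then A $$ (i, y) else 0))"
        by (rule sum.cong) auto
      also have "\<dots> = A $$ (i, x) - A $$ (i, y)"
        using fin xy by (simp add: sum_subtractf)
      also have "\<dots> = 0"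
        using idx[OF i xy(1)] idx[OF i xy(2)] xy(3) by simp
      finally show "(\<Sum>j\<in>J. A $$ (i, j) * ?c j) = 0" .
    qed
    then show False using xy(4) by simp
  qed
  have sub: "?U \<subseteq> set (cols A)"
    using A J by (auto simp: cols_def)
  have Uc: "?U \<subseteq> carrier_vec n"
    using A by auto
  have "lin_indpt ?U"
  proof (rule notI)
    assume "lin_dep ?U"
    then obtain a w where a: "lincomb a ?U = 0\<^sub>v n" "w \<in> ?U" "a w \<noteq> 0"
      using finite_lin_dep[of ?U] fin Uc by auto
    then obtain j where j: "j \<in> J" "w = col A j" by auto
    have "a (col A j) = 0"
    proof (rule inj[of "\<lambda>j. a (col A j)" j, OF _ j(1)])
      fix i assume i: "i < n"
      have "(\<Sum>j\<in>J. A $$ (i, j) * a (col A j)) = (\<Sum>j\<in>J. a (col A j) * col A j $ i)"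
        by (rule sum.cong) (use idx[OF i] in auto)
      also have "\<dots> = lincomb a ?U $ i"
        unfolding lincomb_index[OF i Uc] by (simp add: sum.reindex[OF inj_col])
      finally show "(\<Sum>j\<in>J. A $$ (i, j) * a (col A j)) = 0"
        using a(1) i by simp
    qed
    then show False using a j by simp
  qed
  then have "card ?U \<le> rank A"
    by (rule rank_ge_card_indpt[OF A sub])
  then show ?thesis by (simp add: card_image[OF inj_col])
qed

text \<open>A wedge is a sum of two matrices with product entries, each of rank at most 1, and rank
  is subadditive.\<close>

lemma rank_sum_wedge_le:
  "vec_space.rank n (mat n n (\<lambda>(i, j). \<Sum>(f, g)\<leftarrow>fs. wedge f g (b i) (b j))) \<le> 2 * length fs"
proof (induction fs)
  case Nil
  have "mat n n (\<lambda>(i, j). \<Sum>(f, g)\<leftarrow>[]. wedge f g (b i) (b j)) = 0\<^sub>m n n"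
    by auto
  then show ?case by (simp only: vec_space.rank_0I)
next
  case (Cons x fs)
  obtain f g where x: "x = (f, g)" by force
  let ?A = "mat n n (\<lambda>(i, j). f (b i) * g (b j))"
  let ?B = "mat n n (\<lambda>(i, j). (- g (b i)) * f (b j))"
  let ?C = "mat n n (\<lambda>(i, j). \<Sum>(f, g)\<leftarrow>fs. wedge f g (b i) (b j))"
  have A: "vec_space.rank n ?A \<le> 1"
    by (rule vec_space.rank_le_1_product_entries[of _ n n "\<lambda>i. f (b i)" "\<lambda>j. g (b j)"]) auto
  have B: "vec_space.rank n ?B \<le> 1"
    by (rule vec_space.rank_le_1_product_entries[of _ n n "\<lambda>i. - g (b i)" "\<lambda>j. f (b j)"]) auto
  have "mat n n (\<lambda>(i, j). \<Sum>(f, g)\<leftarrow>x # fs. wedge f g (b i) (b j)) = ?A + ?B + ?C"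
    by (rule eq_matI) (auto simp: x wedge_def)
  moreover have "vec_space.rank n (?A + ?B + ?C) \<le> vec_space.rank n (?A + ?B) + vec_space.rank n ?C"
    by (rule vec_space.rank_subadditive[of _ n n]) auto
  moreover have "vec_space.rank n (?A + ?B) \<le> vec_space.rank n ?A + vec_space.rank n ?B"
    by (rule vec_space.rank_subadditive[of _ n n]) auto
  ultimately show ?case using A B Cons.IH by simp
qed

text \<open>The condition \<open>out\<close> covers table entries with target outside the basis:
  \<open>table_sum\<close> counts them, while the sum defining the commutator matrix runs over the
  basis only.\<close>

lemma commutator_mat_lie_of_table:
  assumes dist: "distinct bs" and z: "\<And>i. i < length bs \<Longrightarrow> z $ i = \<zeta> (bs ! i)"
    and out: "\<And>r. r \<notin> set bs \<Longrightarrow> \<zeta> r = 0"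
  shows "commutator_mat (lie_of_table bs tbl) z =
    mat (length bs) (length bs)
      (\<lambda>(i, j). table_sum tbl \<zeta> (\<lambda>p q. wedge (coord p) (coord q) (bs ! i) (bs ! j)))"
proof -
  have reindex: "(\<Sum>k<length bs. F (bs ! k)) = sum F (set bs)" for F :: "'a \<Rightarrow> complex"
    using sum.reindex_bij_betw[OF bij_betw_nth[OF dist refl refl], of F] by simp
  have delta: "(\<Sum>k\<in>set bs. of_bool (r = k) * \<zeta> k) = \<zeta> r" for r
  proof -
    have "(\<Sum>k\<in>set bs. of_bool (r = k) * \<zeta> k) = (\<Sum>k\<in>set bs. if r = k then \<zeta> k else 0)"
      by (rule sum.cong) auto
    then show ?thesis using out[of r] by simp
  qed
  \<comment> \<open>Both signs share the target condition \<open>R\<close>, so it factors out and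
    the sum over \<open>k\<close> collapses by \<open>delta\<close>.\<close>
  have entry: "((if P \<and> Q \<and> R then c else 0) - (if P' \<and> Q' \<and> R then c else 0)) * y
      = c * (of_bool P * of_bool Q - of_bool P' * of_bool Q') * (of_bool R * y)"
    for P Q P' Q' R and c y :: complex
    by auto
  have "(\<Sum>k\<in>set bs. sconst (lie_of_table bs tbl) a b k * \<zeta> k)
      = table_sum tbl \<zeta> (\<lambda>p q. wedge (coord p) (coord q) a b)" for a b
    unfolding sconst_eq_sum_list
  proof (induction tbl)
    case (Cons x tbl)
    obtain p q c r where x: "x = (p, q, c, r)" by (cases x rule: prod_cases4)
    have "(\<Sum>k\<in>set bs. ((if p = a \<and> q = b \<and> r = k then c else 0)
        - (if p = b \<and> q = a \<and> r = k then c else 0)) * \<zeta> k)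
      = (\<Sum>k\<in>set bs. c * wedge (coord p) (coord q) a b * (of_bool (r = k) * \<zeta> k))"
      by (simp only: wedge_def coord_def entry)
    also have "\<dots> = c * \<zeta> r * wedge (coord p) (coord q) a b"
      unfolding sum_distrib_left[symmetric] delta by simp
    finally have head: "(\<Sum>k\<in>set bs. ((if p = a \<and> q = b \<and> r = k then c else 0)
        - (if p = b \<and> q = a \<and> r = k then c else 0)) * \<zeta> k)
      = c * \<zeta> r * wedge (coord p) (coord q) a b" .
    show ?case
      by (simp only: x table_sum_def list.map sum_list.Cons prod.case distrib_right sum.distrib head
          Cons.IH[unfolded table_sum_def])
  qed (simp add: table_sum_def)
  then show ?thesis
    unfolding commutator_mat_def lie_dim_def basis_lie_of_table
    by (intro cong_mat refl) (simp add: z reindex[symmetric])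
qed

text \<open>\<open>upper\<close> bounds the rank at every point. The expression in
  \<open>lower\<close> is row \<open>a\<close> of the commutator matrix at one point, applied to a
  vector \<alpha> supported on \<open>S\<close>; hence the columns labelled by \<open>S\<close> are
  independent there.\<close>

lemma max_rank_lie_of_table:
  assumes dist: "distinct bs"
    and upper: "\<And>\<zeta>. \<exists>fs::(('a \<Rightarrow> complex) \<times> ('a \<Rightarrow> complex)) list. length fs = N \<and> (\<forall>a b. table_sum tbl \<zeta> (\<lambda>p q. wedge (coord p) (coord q) a b)
        = (\<Sum>(f, g)\<leftarrow>fs. wedge f g a b))"
    and S: "S \<subseteq> set bs" "card S = 2 * N"
    and out: "\<And>r. r \<notin> set bs \<Longrightarrow> \<zeta> r = 0"
    and lower: "\<And>\<alpha> s. (\<And>a. a \<notin> S \<Longrightarrow> \<alpha> a = 0) \<Longrightarrow>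
      (\<And>a. a \<in> set bs \<Longrightarrow> table_sum tbl \<zeta> (\<lambda>p q. coord p a * \<alpha> q - coord q a * \<alpha> p) = 0) \<Longrightarrow>
      s \<in> S \<Longrightarrow> \<alpha> s = 0"
  shows "max_rank (lie_of_table bs tbl) = 2 * N"
proof -
  let ?n = "length bs" and ?g = "lie_of_table bs tbl"
  have dim: "lie_dim ?g = ?n"
    by (simp add: lie_dim_def basis_lie_of_table)
  have le: "vec_space.rank ?n (commutator_mat ?g z) \<le> 2 * N" for z
  proof -
    \<comment> \<open>The coordinate vector becomes a function of labels, extended by 0 off the
      basis.\<close>
    define \<xi> where "\<xi> r = (if r \<in> set bs then z $ (THE i. i < ?n \<and> bs ! i = r) else 0)" for r
    have \<xi>: "z $ i = \<xi> (bs ! i)" if "i < ?n" for i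
    proof -
      have "(THE j. j < ?n \<and> bs ! j = bs ! i) = i"
        using that dist by (intro the_equality) (auto simp: nth_eq_iff_index_eq)
      then show ?thesis using that by (simp add: \<xi>_def)
    qed
    obtain fs where fs: "length fs = N"
      "\<And>a b. table_sum tbl \<xi> (\<lambda>p q. wedge (coord p) (coord q) a b) = (\<Sum>(f, g)\<leftarrow>fs. wedge f g a b)"
      using upper[of \<xi>] by blast
    have "commutator_mat ?g z = mat ?n ?n (\<lambda>(i, j). \<Sum>(f, g)\<leftarrow>fs. wedge f g (bs ! i) (bs ! j))"
      by (subst commutator_mat_lie_of_table[OF dist \<xi>]) (auto simp: \<xi>_def fs(2))
    then show ?thesis
      using rank_sum_wedge_le[of ?n "\<lambda>i. bs ! i" fs] fs(1) by simp
  qed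
  define z where "z = vec ?n (\<lambda>i. \<zeta> (bs ! i))"
  let ?M = "commutator_mat ?g z" and ?J = "{j. j < ?n \<and> bs ! j \<in> S}"
  have M: "?M = mat ?n ?n
      (\<lambda>(i, j). table_sum tbl \<zeta> (\<lambda>p q. wedge (coord p) (coord q) (bs ! i) (bs ! j)))"
    by (rule commutator_mat_lie_of_table[OF dist]) (auto simp: z_def out)
  have bij: "bij_betw (nth bs) ?J S"
  proof (rule bij_betw_imageI)
    show "inj_on (nth bs) ?J"
      using dist by (auto intro: inj_on_nth)
    show "nth bs ` ?J = S"
    proof
      show "S \<subseteq> nth bs ` ?J"
      proof
        fix s assume s: "s \<in> S"
        then obtain i where "i < ?n" "bs ! i = s"
          using S(1) by (metis in_set_conv_nth subsetD)
        then show "s \<in> nth bs ` ?J" using s by auto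
      qed
    qed auto
  qed
  have finS: "finite S" using S(1) finite_subset by blast
  have "card ?J \<le> vec_space.rank ?n ?M"
  proof (rule vec_space.rank_ge_card_cols[of _ _ ?n])
    show "?M \<in> carrier_mat ?n ?n" by (simp add: M)
    show "?J \<subseteq> {..<?n}" by auto
    fix c j
    assume c: "\<And>i. i < ?n \<Longrightarrow> (\<Sum>j\<in>?J. ?M $$ (i, j) * c j) = 0" and j: "j \<in> ?J"
    \<comment> \<open>The coefficients are moved from column indices to labels, so that
      \<open>lower\<close> applies.\<close>
    define \<alpha> where "\<alpha> a = (if a \<in> S then c (the_inv_into ?J (nth bs) a) else 0)" for a
    have \<alpha>c: "\<alpha> (bs ! j) = c j" if "j \<in> ?J" for j
      using that bij by (simp add: \<alpha>_def the_inv_into_f_f bij_betw_def)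
    have delta: "(\<Sum>b\<in>S. coord p b * \<alpha> b) = \<alpha> p" for p
    proof -
      have "(\<Sum>b\<in>S. coord p b * \<alpha> b) = (\<Sum>b\<in>S. if p = b then \<alpha> b else 0)"
        by (rule sum.cong) (auto simp: coord_def)
      then show ?thesis using finS by (simp add: \<alpha>_def)
    qed
    have contract: "(\<Sum>b\<in>S. wedge (coord p) (coord q) a b * \<alpha> b)
        = coord p a * \<alpha> q - coord q a * \<alpha> p" for p q a
    proof -
      have "(\<Sum>b\<in>S. wedge (coord p) (coord q) a b * \<alpha> b)
          = (\<Sum>b\<in>S. coord p a * (coord q b * \<alpha> b) - coord q a * (coord p b * \<alpha> b))"
        by (rule sum.cong) (auto simp: wedge_def algebra_simps)
      then show ?thesis
        by (simp only: sum_subtractf sum_distrib_left[symmetric] delta)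
    qed
    have "\<alpha> (bs ! j) = 0"
    proof (rule lower)
      show "bs ! j \<in> S" using j by simp
      show "\<alpha> a = 0" if "a \<notin> S" for a using that by (simp add: \<alpha>_def)
      fix a assume "a \<in> set bs"
      then obtain i where i: "i < ?n" "a = bs ! i" by (metis in_set_conv_nth)
      have "table_sum tbl \<zeta> (\<lambda>p q. coord p a * \<alpha> q - coord q a * \<alpha> p)
          = table_sum tbl \<zeta> (\<lambda>p q. \<Sum>b\<in>S. wedge (coord p) (coord q) a b * \<alpha> b)"
        by (simp only: contract)
      also have "\<dots> = (\<Sum>b\<in>S. table_sum tbl \<zeta> (\<lambda>p q. wedge (coord p) (coord q) a b) * \<alpha> b)"
        by (simp add: sum_table_sum table_sum_mult_right)
      also have "\<dots> = (\<Sum>j\<in>?J. table_sum tbl \<zeta> (\<lambda>p q. wedge (coord p) (coord q) a (bs ! j)) * \<alpha> (bs ! j))"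
        by (rule sum.reindex_bij_betw[OF bij, symmetric])
      also have "\<dots> = (\<Sum>j\<in>?J. ?M $$ (i, j) * c j)"
        by (rule sum.cong) (use i \<alpha>c in \<open>auto simp: M\<close>)
      finally show "table_sum tbl \<zeta> (\<lambda>p q. coord p a * \<alpha> q - coord q a * \<alpha> p) = 0"
        using c[OF i(1)] by simp
    qed
    then show "c j = 0" using \<alpha>c[OF j] by simp
  qed
  then have ge: "2 * N \<le> vec_space.rank ?n ?M"
    using bij_betw_same_card[OF bij] S(2) by simp
  have "max_rank ?g = Max {vec_space.rank ?n (commutator_mat ?g z) |z. z \<in> carrier_vec ?n}"
    by (simp add: max_rank_def dim)
  also have "\<dots> = 2 * N"
  proof (rule Max_eqI)
    have "{vec_space.rank ?n (commutator_mat ?g z) |z. z \<in> carrier_vec ?n} \<subseteq> {..2 * N}"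
      using le by auto
    then show "finite {vec_space.rank ?n (commutator_mat ?g z) |z. z \<in> carrier_vec ?n}"
      using finite_subset by blast
    have "z \<in> carrier_vec ?n" by (simp add: z_def)
    moreover have "2 * N = vec_space.rank ?n ?M" using le[of z] ge by simp
    ultimately show "2 * N \<in> {vec_space.rank ?n (commutator_mat ?g z) |z. z \<in> carrier_vec ?n}"
      by blast
  qed (use le in auto)
  finally show ?thesis .
qed

subsection \<open>Wedge decompositions and maximal ranks\<close>

lemma table_sum_d_even:
  "table_sum (d_even_table m) \<zeta> F =
     \<zeta> (X 2) * F (X 0) (X 1) + \<zeta> (X 3) * F (X 0) (X 2)
     + \<zeta> (X 0) * F (V 1) (X 0) + 2 * \<zeta> (X 1) * F (V 1) (X 1)
     + 3 * \<zeta> (X 2) * F (V 1) (X 2) + 4 * \<zeta> (X 3) * F (V 1) (X 3)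
     + \<zeta> (X 1) * F (V 2) (X 1) + \<zeta> (X 2) * F (V 2) (X 2) + \<zeta> (X 3) * F (V 2) (X 3)
     + (\<Sum>i\<in>{1..<m - 1}. \<zeta> (X 3) * F (Y (2 * i - 1)) (Y (2 * i))
         + (of_nat i + 4) * \<zeta> (Y (2 * i - 1)) * F (V 1) (Y (2 * i - 1))
         - of_nat i * \<zeta> (Y (2 * i)) * F (V 1) (Y (2 * i))
         + \<zeta> (Y (2 * i)) * F (V 2) (Y (2 * i))
         + \<zeta> (Y (2 * i - 1)) * F (V (i + 2)) (Y (2 * i - 1))
         - \<zeta> (Y (2 * i)) * F (V (i + 2)) (Y (2 * i)))"
  unfolding table_sum_def d_even_table_def upts
  by (simp add: o_def sum_list_upt sum.distrib sum_subtractf sum_negf flip: numeral_2_eq_2)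

lemma table_sum_d_odd:
  "table_sum (d_odd_table m) \<zeta> F =
     \<zeta> (X 2) * F (X 0) (X 1) + \<zeta> (X 3) * F (X 0) (X 2)
     + \<zeta> (X 3) * F (X 1) (Y (2 * m - 3))
     + \<zeta> (X 0) * F (V 1) (X 0) + 2 * \<zeta> (X 1) * F (V 1) (X 1)
     + 3 * \<zeta> (X 2) * F (V 1) (X 2) + 4 * \<zeta> (X 3) * F (V 1) (X 3)
     + 2 * \<zeta> (Y (2 * m - 3)) * F (V 1) (Y (2 * m - 3))
     + \<zeta> (X 1) * F (V 2) (X 1) + \<zeta> (X 2) * F (V 2) (X 2) + \<zeta> (X 3) * F (V 2) (X 3)
     + (\<Sum>i\<in>{1..<m - 1}. \<zeta> (X 3) * F (Y (2 * i - 1)) (Y (2 * i))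
         + (of_nat i + 4) * \<zeta> (Y (2 * i - 1)) * F (V 1) (Y (2 * i - 1))
         - of_nat i * \<zeta> (Y (2 * i)) * F (V 1) (Y (2 * i))
         + \<zeta> (Y (2 * i)) * F (V 2) (Y (2 * i))
         + \<zeta> (Y (2 * i - 1)) * F (V (i + 2)) (Y (2 * i - 1))
         - \<zeta> (Y (2 * i)) * F (V (i + 2)) (Y (2 * i)))"
  unfolding table_sum_def d_odd_table_def upts
  by (simp add: o_def sum_list_upt sum.distrib sum_subtractf sum_negf flip: numeral_2_eq_2)

lemma table_sum_d5':
  "table_sum d5'_table \<zeta> F =
     \<zeta> (X 2) * F (X 0) (X 1) + \<zeta> (X 3) * F (X 0) (X 2) + \<zeta> (Y 1) * F (X 1) (X 2)
     + \<zeta> (X 0) * F (V 1) (X 0) + 2 * \<zeta> (X 1) * F (V 1) (X 1)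
     + 3 * \<zeta> (X 2) * F (V 1) (X 2) + 4 * \<zeta> (X 3) * F (V 1) (X 3) + 5 * \<zeta> (Y 1) * F (V 1) (Y 1)
     + \<zeta> (X 1) * F (V 2) (X 1) + \<zeta> (X 2) * F (V 2) (X 2) + \<zeta> (X 3) * F (V 2) (X 3)
     + 2 * \<zeta> (Y 1) * F (V 2) (Y 1)"
  unfolding table_sum_def d5'_table_def upts
  by (simp flip: numeral_2_eq_2)

lemma sum_of_bool_eq_mult:
  fixes g :: "'i \<Rightarrow> complex"
  assumes "finite A" "j \<in> A"
  shows "(\<Sum>i\<in>A. of_bool (i = j) * g i) = g j"
proof -
  have "(\<Sum>i\<in>A. of_bool (i = j) * g i) = (\<Sum>i\<in>A. if i = j then g i else 0)"
    by (rule sum.cong) auto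
  then show ?thesis using assms by simp
qed

text \<open>For \<open>x = 0\<close> the form \<open>v\<close> factors out. Otherwise
  \<open>p\<close> and \<open>q\<close> are shifted by multiples of \<open>v\<close> chosen to
  produce the two mixed terms.\<close>

lemma decomposable_in_3_space:
  "\<exists>f g. \<forall>a b. wedge f g a b = x * wedge p q a b + y * wedge v p a b + z * wedge v q a b"
proof (cases "x = 0")
  case True
  then show ?thesis
    by (intro exI[of _ v] exI[of _ "\<lambda>b. y * p b + z * q b"]) (simp add: wedge_def algebra_simps)
next
  case False
  then show ?thesis
    by (intro exI[of _ "\<lambda>b. p b + z / x * v b"] exI[of _ "\<lambda>b. x * q b - y * v b"])
      (simp add: wedge_def field_simps)
qed

text \<open>A 2-form in five variables has rank at most 4. For nonzero \<open>x\<close> the part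
  without \<open>v\<close> is \<open>p\<close> wedge \<open>y q + x r\<close> plus \<open>q\<close>
  wedge \<open>x s\<close>, and shifting all four factors by multiples of \<open>v\<close> absorbs
  the rest; the summand \<open>c2 * y / x\<close> cancels the \<open>v\<close>, \<open>q\<close>
  term created by the first wedge.\<close>

lemma sum_of_two_wedges_in_5_space:
  "\<exists>f g h k. \<forall>a b. wedge f g a b + wedge h k a b =
     y * wedge p q a b + x * wedge p r a b + x * wedge q s a b
     + wedge v (\<lambda>b. c0 * p b + c1 * q b + c2 * r b + c3 * s b) a b"
proof (cases "x = 0")
  case True
  then show ?thesis
    by (intro exI[of _ p] exI[of _ "\<lambda>b. y * q b"] exI[of _ v]
        exI[of _ "\<lambda>b. c0 * p b + c1 * q b + c2 * r b + c3 * s b"]) (simp add: wedge_def algebra_simps)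
next
  case False
  then show ?thesis
    by (intro exI[of _ "\<lambda>b. p b + c2 / x * v b"] exI[of _ "\<lambda>b. y * q b + x * r b - c0 * v b"]
        exI[of _ "\<lambda>b. q b + c3 / x * v b"] exI[of _ "\<lambda>b. x * s b + (c2 * y / x - c1) * v b"])
      (simp add: wedge_def field_simps)
qed

lemma sum_list_wedge_map:
  "(\<Sum>(f, g)\<leftarrow>map (\<lambda>i. (f i, g i)) [k..<l]. wedge f g a b) = (\<Sum>i\<in>{k..<l}. wedge (f i) (g i) a b)"
  by (simp add: o_def sum_list_upt)

section \<open>The maximal ranks of the three kinds of algebras\<close>

lemma max_rank_d_even:
  assumes m: "m \<ge> 3"
  shows "max_rank (d_even m) = 2 * (m + 1)"
  unfolding d_even_def
\<comment> \<open>With \<open>X 3\<close> alone, the columns of \<open>V 1\<close> and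
  \<open>V 2\<close> would be proportional; the additional coordinate at \<open>X 1\<close>
  separates them. The columns of \<open>V 3\<close>, ..., \<open>V m\<close> vanish at this point,
  so \<open>S\<close> omits them.\<close>
proof (rule max_rank_lie_of_table[where \<zeta> = "\<lambda>r. of_bool (r = X 1 \<or> r = X 3)"
      and S = "set (map X [0..<4] @ map Y [1..<2 * m - 3] @ map V [1..<3])"])
  let ?B = "map X [0..<4] @ map Y [1..<2 * m - 3] @ map V [1..<m + 1]"
  let ?S = "map X [0..<4] @ map Y [1..<2 * m - 3] @ map V [1..<3]"
  show "distinct ?B"
    by (auto simp: distinct_map inj_on_def)
  show "set ?S \<subseteq> set ?B"
    using m by auto
  have "distinct ?S"
    by (auto simp: distinct_map inj_on_def)
  from distinct_card[OF this] show "card (set ?S) = 2 * (m + 1)"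
    using m by simp
  show "of_bool (r = X 1 \<or> r = X 3) = (0 :: complex)" if "r \<notin> set ?B" for r
    using that by auto
next
  fix \<zeta> :: "gen \<Rightarrow> complex"
  \<comment> \<open>Three wedges with first factors \<open>X 0\<close>, \<open>V 1\<close>,
    \<open>V 2\<close> collect all other brackets; together with these \<open>m - 2\<close> they
    number \<open>m + 1\<close>.\<close>
  obtain f g where fg: "\<And>i a b. wedge (f i) (g i) a b =
      \<zeta> (X 3) * wedge (coord (Y (2 * i - 1))) (coord (Y (2 * i))) a b
      + \<zeta> (Y (2 * i - 1)) * wedge (coord (V (i + 2))) (coord (Y (2 * i - 1))) a b
      + (- \<zeta> (Y (2 * i))) * wedge (coord (V (i + 2))) (coord (Y (2 * i))) a b"
    using decomposable_in_3_space[of "\<zeta> (X 3)" "coord (Y (2 * i - 1))" "coord (Y (2 * i))"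
        "\<zeta> (Y (2 * i - 1))" "coord (V (i + 2))" "- \<zeta> (Y (2 * i))" for i]
    by metis
  let ?w1 = "\<lambda>b. \<zeta> (X 0) * coord (X 0) b + 2 * \<zeta> (X 1) * coord (X 1) b
      + 3 * \<zeta> (X 2) * coord (X 2) b + 4 * \<zeta> (X 3) * coord (X 3) b"
  let ?u1 = "\<lambda>i b. (of_nat i + 4) * \<zeta> (Y (2 * i - 1)) * coord (Y (2 * i - 1)) b
      - of_nat i * \<zeta> (Y (2 * i)) * coord (Y (2 * i)) b"
  let ?w2 = "\<lambda>b. \<zeta> (X 1) * coord (X 1) b + \<zeta> (X 2) * coord (X 2) b + \<zeta> (X 3) * coord (X 3) b"
  let ?u2 = "\<lambda>i b. \<zeta> (Y (2 * i)) * coord (Y (2 * i)) b"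
  let ?fs = "[(coord (X 0), \<lambda>b. \<zeta> (X 2) * coord (X 1) b + \<zeta> (X 3) * coord (X 2) b),
      (coord (V 1), \<lambda>b. ?w1 b + (\<Sum>i\<in>{1..<m - 1}. ?u1 i b)),
      (coord (V 2), \<lambda>b. ?w2 b + (\<Sum>i\<in>{1..<m - 1}. ?u2 i b))]
      @ map (\<lambda>i. (f i, g i)) [1..<m - 1]"
  have "table_sum (d_even_table m) \<zeta> (\<lambda>p q. wedge (coord p) (coord q) a b)
      = (\<Sum>(f, g)\<leftarrow>?fs. wedge f g a b)" for a b
  proof -
    \<comment> \<open>The shape of \<open>table_sum_d_even\<close> is reproduced, a fixed part plus
      one sum over \<open>i\<close>, so that the two can be compared part by part and summand by
      summand.\<close>
    have "(\<Sum>(f, g)\<leftarrow>?fs. wedge f g a b) =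
      wedge (coord (X 0)) (\<lambda>b. \<zeta> (X 2) * coord (X 1) b + \<zeta> (X 3) * coord (X 2) b) a b
      + wedge (coord (V 1)) ?w1 a b + wedge (coord (V 2)) ?w2 a b
      + (\<Sum>i\<in>{1..<m - 1}. wedge (coord (V 1)) (?u1 i) a b + wedge (coord (V 2)) (?u2 i) a b
          + wedge (f i) (g i) a b)"
      unfolding map_append sum_list_append sum_list_wedge_map sum.distrib
      by (simp only: list.map sum_list.Cons sum_list.Nil prod.case
          wedge_add_right[of _ ?w1] wedge_add_right[of _ ?w2] wedge_sum_right) (simp only: ac_simps add_0_left add_0_right)
    also have "\<dots> = table_sum (d_even_table m) \<zeta> (\<lambda>p q. wedge (coord p) (coord q) a b)"
      unfolding table_sum_d_even fg
      by (rule arg_cong2[of _ _ _ _ "(+)"], simp only: wedge_def, simp add: algebra_simps,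
          rule sum.cong[OF refl], simp only: wedge_def, simp add: algebra_simps)
    finally show ?thesis by simp
  qed
  moreover have "length ?fs = m + 1"
    using m by simp
  ultimately show "\<exists>fs. length fs = m + 1 \<and> (\<forall>a b. table_sum (d_even_table m) \<zeta>
      (\<lambda>p q. wedge (coord p) (coord q) a b) = (\<Sum>(f, g)\<leftarrow>fs. wedge f g a b))"
    by blast
next
  fix \<alpha> s
  let ?B = "map X [0..<4] @ map Y [1..<2 * m - 3] @ map V [1..<m + 1]"
  let ?S = "map X [0..<4] @ map Y [1..<2 * m - 3] @ map V [1..<3]"
  assume eq: "\<And>a. a \<in> set ?B \<Longrightarrow> table_sum (d_even_table m) (\<lambda>r. of_bool (r = X 1 \<or> r = X 3))
      (\<lambda>p q. coord p a * \<alpha> q - coord q a * \<alpha> p) = 0"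
    and s: "s \<in> set ?S"
  define F where "F a p q = coord p a * \<alpha> q - coord q a * \<alpha> p" for a p q
  have E: "F a (X 0) (X 2) + 2 * F a (V 1) (X 1) + 4 * F a (V 1) (X 3) + F a (V 2) (X 1)
      + F a (V 2) (X 3) + (\<Sum>i\<in>{1..<m - 1}. F a (Y (2 * i - 1)) (Y (2 * i))) = 0"
    if "a \<in> set ?B" for a
    using eq[OF that] unfolding F_def[symmetric] table_sum_d_even by simp
  note simps = F_def coord_def parity sum_of_bool_eq_mult sum_negf
  have X02: "\<alpha> (X 2) = 0" "\<alpha> (X 0) = 0"
    using E[of "X 0"] E[of "X 2"] by (simp_all add: simps)
  \<comment> \<open>Rows \<open>X 1\<close>, \<open>X 3\<close> give a system for
    \<open>V 1\<close>, \<open>V 2\<close>, and rows \<open>V 1\<close>, \<open>V 2\<close> one for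
    \<open>X 1\<close>, \<open>X 3\<close>. Both have determinant -2, coming from the weights 2, 4
    and 1, 1.\<close>
  have V: "- (2 * \<alpha> (V 1)) = \<alpha> (V 2)" "- (4 * \<alpha> (V 1)) = \<alpha> (V 2)"
    using E[of "X 1"] E[of "X 3"] by (simp_all add: simps)
  have X: "2 * \<alpha> (X 1) + 4 * \<alpha> (X 3) = 0" "\<alpha> (X 1) + \<alpha> (X 3) = 0"
  proof -
    have "V 1 \<in> set ?B" "V 2 \<in> set ?B"
      using m by auto
    from this[THEN E] show "2 * \<alpha> (X 1) + 4 * \<alpha> (X 3) = 0" "\<alpha> (X 1) + \<alpha> (X 3) = 0"
      by (simp_all add: simps)
  qed
  have "2 * \<alpha> (V 1) = - (2 * \<alpha> (V 1)) - - (4 * \<alpha> (V 1))"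
    by simp
  moreover have "2 * \<alpha> (X 3) = (2 * \<alpha> (X 1) + 4 * \<alpha> (X 3)) - 2 * (\<alpha> (X 1) + \<alpha> (X 3))"
    by (simp only: ring_distribs) simp
  ultimately have "\<alpha> (V 1) = 0" "\<alpha> (X 3) = 0"
    unfolding V X by simp_all
  then have VX: "\<alpha> (V 1) = 0" "\<alpha> (V 2) = 0" "\<alpha> (X 1) = 0" "\<alpha> (X 3) = 0"
    using V X by simp_all
  \<comment> \<open>Each member of a pair is annihilated by the row of its partner.\<close>
  have Y: "\<alpha> (Y (2 * j - 1)) = 0" "\<alpha> (Y (2 * j)) = 0" if "1 \<le> j" "j < m - 1" for j
  proof -
    have "2 * j < 2 * m - 3" "1 \<le> 2 * j" "2 * j - 1 < 2 * m - 3" "1 \<le> 2 * j - 1"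
      using that by auto
    then have "Y (2 * j) \<in> set ?B" "Y (2 * j - 1) \<in> set ?B"
      by (simp_all add: image_iff)
    from this[THEN E] show "\<alpha> (Y (2 * j - 1)) = 0" "\<alpha> (Y (2 * j)) = 0"
      using that by (simp_all add: simps)
  qed
  from s consider i where "s = X i" "i < 4" | k where "s = Y k" "1 \<le> k" "k < 2 * m - 3"
    | "s = V 1" | "s = V 2"
    by force
  then show "\<alpha> s = 0"
  proof cases
    case 1
    then have "i = 0 \<or> i = 1 \<or> i = 2 \<or> i = 3" by auto
    then show ?thesis using 1 X02 VX by auto
  next
    case 2
    then obtain j where "k = 2 * j - 1 \<or> k = 2 * j" "1 \<le> j" "j < m - 1"
      by (intro that[of "(k + 1) div 2"]) presburger+
    then show ?thesis using 2 Y by auto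
  qed (use VX in auto)
qed

text \<open>Splitting as in the even case would cost one wedge more for
  \<open>[X 1, Y (2 * m - 3)]\<close>. A change of basis among the \<open>V\<close> leaves, besides
  the pair wedges and one wedge for \<open>V 2\<close>, a 2-form in five variables, which costs only
  two.\<close>

lemma max_rank_d_odd:
  assumes m: "m \<ge> 2"
  shows "max_rank (d_odd m) = 2 * (m + 1)"
  unfolding d_odd_def
\<comment> \<open>At this point the form matches \<open>X 0\<close> with \<open>X 2\<close>,
  \<open>X 1\<close> with the last \<open>Y\<close>, the members of each pair, and
  \<open>V 1\<close> with \<open>X 3\<close>. The column of \<open>V 2\<close> is proportional to
  that of \<open>V 1\<close>, so \<open>S\<close> omits it.\<close>
proof (rule max_rank_lie_of_table[where \<zeta> = "\<lambda>r. of_bool (r = X 3)"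
      and S = "set (map X [0..<4] @ map Y [1..<2 * m - 2] @ [V 1])"])
  let ?B = "map X [0..<4] @ map Y [1..<2 * m - 2] @ map V [1..<m + 1]"
  let ?S = "map X [0..<4] @ map Y [1..<2 * m - 2] @ [V 1]"
  show "distinct ?B"
    by (auto simp: distinct_map inj_on_def)
  show "set ?S \<subseteq> set ?B"
    using m by auto
  have "distinct ?S"
    by (auto simp: distinct_map inj_on_def)
  from distinct_card[OF this] show "card (set ?S) = 2 * (m + 1)"
    using m by simp
  show "of_bool (r = X 3) = (0 :: complex)" if "r \<notin> set ?B" for r
    using that by auto
next
  fix \<zeta> :: "gen \<Rightarrow> complex"
  \<comment> \<open>In the basis \<open>V 1 - 4 V 2 - (\<Sum>i. (i + 4) V (i + 2)), V 2, \<dots>\<close>, whose dual basis contains \<open>?v2\<close> and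
    \<open>?v i\<close>, the first vector acts trivially on \<open>X 3\<close> and on all \<open>Y\<close> but the last.\<close>
  let ?v2 = "\<lambda>b. coord (V 2) b + 4 * coord (V 1) b"
  let ?v = "\<lambda>i b. coord (V (i + 2)) b + (of_nat i + 4) * coord (V 1) b"
  obtain f g where fg: "\<And>i a b. wedge (f i) (g i) a b =
      \<zeta> (X 3) * wedge (coord (Y (2 * i - 1))) (coord (Y (2 * i))) a b
      + \<zeta> (Y (2 * i - 1)) * wedge (?v i) (coord (Y (2 * i - 1))) a b
      + (- \<zeta> (Y (2 * i))) * wedge (?v i) (coord (Y (2 * i))) a b"
    using decomposable_in_3_space[of "\<zeta> (X 3)" "coord (Y (2 * i - 1))" "coord (Y (2 * i))"
        "\<zeta> (Y (2 * i - 1))" "?v i" "- \<zeta> (Y (2 * i))" for i]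
    by metis
  \<comment> \<open>The coefficients 1, -2, -1, 2 are the weights of the new first vector on
    \<open>X 0\<close>, \<open>X 1\<close>, \<open>X 2\<close> and the last
    \<open>Y\<close>.\<close>
  obtain f1 g1 f2 g2 where fg12: "\<And>a b. wedge f1 g1 a b + wedge f2 g2 a b =
      \<zeta> (X 2) * wedge (coord (X 0)) (coord (X 1)) a b + \<zeta> (X 3) * wedge (coord (X 0)) (coord (X 2)) a b
      + \<zeta> (X 3) * wedge (coord (X 1)) (coord (Y (2 * m - 3))) a b
      + wedge (coord (V 1)) (\<lambda>b. \<zeta> (X 0) * coord (X 0) b + (- 2 * \<zeta> (X 1)) * coord (X 1) b
          + (- \<zeta> (X 2)) * coord (X 2) b + 2 * \<zeta> (Y (2 * m - 3)) * coord (Y (2 * m - 3)) b) a b"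
    using sum_of_two_wedges_in_5_space[of "\<zeta> (X 2)" "coord (X 0)" "coord (X 1)" "\<zeta> (X 3)" "coord (X 2)"
        "coord (Y (2 * m - 3))" "coord (V 1)" "\<zeta> (X 0)" "- 2 * \<zeta> (X 1)" "- \<zeta> (X 2)"
        "2 * \<zeta> (Y (2 * m - 3))"]
    by metis
  let ?w2 = "\<lambda>b. \<zeta> (X 1) * coord (X 1) b + \<zeta> (X 2) * coord (X 2) b + \<zeta> (X 3) * coord (X 3) b"
  let ?u2 = "\<lambda>i b. \<zeta> (Y (2 * i)) * coord (Y (2 * i)) b"
  let ?fs = "[(f1, g1), (f2, g2), (?v2, \<lambda>b. ?w2 b + (\<Sum>i\<in>{1..<m - 1}. ?u2 i b))]
      @ map (\<lambda>i. (f i, g i)) [1..<m - 1]"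
  have "table_sum (d_odd_table m) \<zeta> (\<lambda>p q. wedge (coord p) (coord q) a b)
      = (\<Sum>(f, g)\<leftarrow>?fs. wedge f g a b)" for a b
  proof -
    have "(\<Sum>(f, g)\<leftarrow>?fs. wedge f g a b) =
      (wedge f1 g1 a b + wedge f2 g2 a b) + wedge ?v2 ?w2 a b
      + (\<Sum>i\<in>{1..<m - 1}. wedge ?v2 (?u2 i) a b + wedge (f i) (g i) a b)"
      unfolding map_append sum_list_append sum_list_wedge_map sum.distrib
      by (simp only: list.map sum_list.Cons sum_list.Nil prod.case
          wedge_add_right[of _ ?w2] wedge_sum_right) (simp only: ac_simps add_0_left add_0_right)
    also have "\<dots> = table_sum (d_odd_table m) \<zeta> (\<lambda>p q. wedge (coord p) (coord q) a b)"
      unfolding table_sum_d_odd fg fg12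
      by (rule arg_cong2[of _ _ _ _ "(+)"], simp only: wedge_def, simp add: algebra_simps,
          rule sum.cong[OF refl], simp only: wedge_def, simp add: algebra_simps)
    finally show ?thesis by simp
  qed
  moreover have "length ?fs = m + 1"
    using m by simp
  ultimately show "\<exists>fs. length fs = m + 1 \<and> (\<forall>a b. table_sum (d_odd_table m) \<zeta>
      (\<lambda>p q. wedge (coord p) (coord q) a b) = (\<Sum>(f, g)\<leftarrow>fs. wedge f g a b))"
    by blast
next
  fix \<alpha> s
  let ?B = "map X [0..<4] @ map Y [1..<2 * m - 2] @ map V [1..<m + 1]"
  let ?S = "map X [0..<4] @ map Y [1..<2 * m - 2] @ [V 1]"
  assume supp: "\<And>a. a \<notin> set ?S \<Longrightarrow> \<alpha> a = 0"
    and eq: "\<And>a. a \<in> set ?B \<Longrightarrow> table_sum (d_odd_table m) (\<lambda>r. of_bool (r = X 3))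
      (\<lambda>p q. coord p a * \<alpha> q - coord q a * \<alpha> p) = 0"
    and s: "s \<in> set ?S"
  define F where "F a p q = coord p a * \<alpha> q - coord q a * \<alpha> p" for a p q
  have E: "F a (X 0) (X 2) + F a (X 1) (Y (2 * m - 3)) + 4 * F a (V 1) (X 3)
      + F a (V 2) (X 3) + (\<Sum>i\<in>{1..<m - 1}. F a (Y (2 * i - 1)) (Y (2 * i))) = 0"
    if "a \<in> set ?B" for a
    using eq[OF that] unfolding F_def[symmetric] table_sum_d_odd by simp
  note simps = F_def coord_def parity parity_last sum_of_bool_eq_mult sum_negf
  have V2: "\<alpha> (V 2) = 0"
    by (rule supp) auto
  have X02: "\<alpha> (X 2) = 0" "\<alpha> (X 0) = 0"
    using E[of "X 0"] E[of "X 2"] by (simp_all add: simps)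
  have V1: "\<alpha> (V 1) = 0"
    using E[of "X 3"] V2 by (simp add: simps)
  have "V 2 \<in> set ?B"
    using m by auto
  from E[OF this] have X3: "\<alpha> (X 3) = 0"
    by (simp add: simps)
  have "Y (2 * m - 3) \<in> set ?B"
    using m by (simp add: image_iff, arith)
  from E[OF this] have X1: "\<alpha> (X 1) = 0"
    using m by (simp add: simps)
  have YL: "\<alpha> (Y (2 * m - 3)) = 0"
    using E[of "X 1"] by (simp add: simps)
  have Y: "\<alpha> (Y (2 * j - 1)) = 0" "\<alpha> (Y (2 * j)) = 0" if "1 \<le> j" "j < m - 1" for j
  proof -
    have "2 * j < 2 * m - 2" "1 \<le> 2 * j" "2 * j - 1 < 2 * m - 2" "1 \<le> 2 * j - 1"
      using that by auto
    then have "Y (2 * j) \<in> set ?B" "Y (2 * j - 1) \<in> set ?B"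
      by (simp_all add: image_iff)
    from this[THEN E] show "\<alpha> (Y (2 * j - 1)) = 0" "\<alpha> (Y (2 * j)) = 0"
      using that m by (simp_all add: simps)
  qed
  from s consider i where "s = X i" "i < 4" | k where "s = Y k" "1 \<le> k" "k < 2 * m - 2" | "s = V 1"
    by force
  then show "\<alpha> s = 0"
  proof cases
    case 1
    then have "i = 0 \<or> i = 1 \<or> i = 2 \<or> i = 3" by auto
    then show ?thesis using 1 X02 X1 X3 by auto
  next
    case 2
    show ?thesis
    proof (cases "k = 2 * m - 3")
      case False
      \<comment> \<open>The remaining labels run up to \<open>2 * m - 4\<close> and are exactly the
        pairs.\<close>
      with 2 obtain j where "k = 2 * j - 1 \<or> k = 2 * j" "1 \<le> j" "j < m - 1"
        by (intro that[of "(k + 1) div 2"]) presburger+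
      then show ?thesis using 2 Y by auto
    qed (use 2 YL in simp)
  qed (use V1 in auto)
qed

lemma max_rank_d5': "max_rank d5' = 2 * 3"
  unfolding d5'_def
\<comment> \<open>Here the part on \<open>X 0\<close>, \<open>X 1\<close>, \<open>X 2\<close> is
  \<open>coord (X 0) + coord (X 1)\<close> wedge \<open>coord (X 2)\<close>, so the columns of
  \<open>X 0\<close> and \<open>X 1\<close> agree and \<open>S\<close> keeps one of them.\<close>
proof (rule max_rank_lie_of_table[where \<zeta> = "\<lambda>r. of_bool (r = X 3 \<or> r = Y 1)"
      and S = "{X 1, X 2, X 3, Y 1, V 1, V 2}"])
  let ?B = "map X [0..<4] @ [Y 1] @ map V [1..<3]"
  show "distinct ?B"
    by (auto simp: distinct_map inj_on_def)
  show "{X 1, X 2, X 3, Y 1, V 1, V 2} \<subseteq> set ?B"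
    by auto
  show "of_bool (r = X 3 \<or> r = Y 1) = (0 :: complex)" if "r \<notin> set ?B" for r
    using that by auto
next
  fix \<zeta> :: "gen \<Rightarrow> complex"
  \<comment> \<open>The brackets among the \<open>X\<close> involve only three linear forms, hence
    cost one wedge; \<open>V 1\<close> and \<open>V 2\<close> cost one each.\<close>
  obtain f g where fg: "\<And>a b. wedge f g a b =
      \<zeta> (Y 1) * wedge (coord (X 1)) (coord (X 2)) a b
      + \<zeta> (X 2) * wedge (coord (X 0)) (coord (X 1)) a b
      + \<zeta> (X 3) * wedge (coord (X 0)) (coord (X 2)) a b"
    using decomposable_in_3_space by metis
  let ?fs = "[(f, g),
      (coord (V 1), \<lambda>b. \<zeta> (X 0) * coord (X 0) b + 2 * \<zeta> (X 1) * coord (X 1) b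
        + 3 * \<zeta> (X 2) * coord (X 2) b + 4 * \<zeta> (X 3) * coord (X 3) b + 5 * \<zeta> (Y 1) * coord (Y 1) b),
      (coord (V 2), \<lambda>b. \<zeta> (X 1) * coord (X 1) b + \<zeta> (X 2) * coord (X 2) b
        + \<zeta> (X 3) * coord (X 3) b + 2 * \<zeta> (Y 1) * coord (Y 1) b)]"
  have "table_sum d5'_table \<zeta> (\<lambda>p q. wedge (coord p) (coord q) a b)
      = (\<Sum>(f, g)\<leftarrow>?fs. wedge f g a b)" for a b
    unfolding table_sum_d5' list.map sum_list.Cons sum_list.Nil prod.case fg
    by (simp only: wedge_def) (simp add: algebra_simps)
  moreover have "length ?fs = 3"
    by simp
  ultimately show "\<exists>fs. length fs = 3 \<and> (\<forall>a b. table_sum d5'_table \<zeta>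
      (\<lambda>p q. wedge (coord p) (coord q) a b) = (\<Sum>(f, g)\<leftarrow>fs. wedge f g a b))"
    by blast
next
  fix \<alpha> s
  let ?B = "map X [0..<4] @ [Y 1] @ map V [1..<3]"
  assume supp: "\<And>a. a \<notin> {X 1, X 2, X 3, Y 1, V 1, V 2} \<Longrightarrow> \<alpha> a = 0"
    and eq: "\<And>a. a \<in> set ?B \<Longrightarrow> table_sum d5'_table (\<lambda>r. of_bool (r = X 3 \<or> r = Y 1))
      (\<lambda>p q. coord p a * \<alpha> q - coord q a * \<alpha> p) = 0"
    and s: "s \<in> {X 1, X 2, X 3, Y 1, V 1, V 2}"
  define F where "F a p q = coord p a * \<alpha> q - coord q a * \<alpha> p" for a p q
  have E: "F a (X 0) (X 2) + F a (X 1) (X 2) + 4 * F a (V 1) (X 3) + 5 * F a (V 1) (Y 1)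
      + F a (V 2) (X 3) + 2 * F a (V 2) (Y 1) = 0"
    if "a \<in> set ?B" for a
    using eq[OF that] unfolding F_def[symmetric] table_sum_d5' by simp
  note simps = F_def coord_def
  have X12: "\<alpha> (X 2) = 0" "\<alpha> (X 1) = 0"
    using E[of "X 1"] E[of "X 2"] supp[of "X 0"] by (simp_all add: simps)
  have V: "- (4 * \<alpha> (V 1)) = \<alpha> (V 2)" "- (5 * \<alpha> (V 1)) = 2 * \<alpha> (V 2)"
    using E[of "X 3"] E[of "Y 1"] by (simp_all add: simps)
  have XY: "4 * \<alpha> (X 3) + 5 * \<alpha> (Y 1) = 0" "\<alpha> (X 3) + 2 * \<alpha> (Y 1) = 0"
    using E[of "V 1"] E[of "V 2"] by (simp_all add: simps)
  \<comment> \<open>Twice the first relation in \<open>V\<close> minus the second. The weights 4, 5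
    and 1, 2 of \<open>X 3\<close>, \<open>Y 1\<close> have determinant 3, so this system and
    \<open>XY\<close> are both regular.\<close>
  have "3 * \<alpha> (V 1) = 2 * - (4 * \<alpha> (V 1)) - - (5 * \<alpha> (V 1)) + 6 * \<alpha> (V 1)"
    by simp
  also have "\<dots> = 6 * \<alpha> (V 1)"
    unfolding V by simp
  finally have V1: "\<alpha> (V 1) = 0"
    by simp
  have "3 * \<alpha> (Y 1) = 4 * (\<alpha> (X 3) + 2 * \<alpha> (Y 1)) - (4 * \<alpha> (X 3) + 5 * \<alpha> (Y 1))"
    by (simp only: ring_distribs) simp
  also have "\<dots> = 0"
    unfolding XY by simp
  finally have Y1: "\<alpha> (Y 1) = 0"
    by simp
  have "\<alpha> (V 2) = 0" "\<alpha> (X 3) = 0"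
    using V V1 XY Y1 by simp_all
  with V1 Y1 show "\<alpha> s = 0"
    using s X12 by auto
qed auto

theorem lemma1:
  shows "(\<forall>m\<ge>3. num_invariants (d_even m) = m - 2)
    \<and> (\<forall>m\<ge>2. num_invariants (d_odd m) = m - 1)
    \<and> num_invariants d5' = 1"
proof (intro conjI allI impI)
  fix m :: nat assume m: "m \<ge> 3"
  \<comment> \<open>The basis has \<open>4 + (2 * m - 4) + m\<close> elements, and
    \<open>3 * m - 2 * (m + 1) = m - 2\<close>. The odd family has one more \<open>Y\<close> and the
    same rank.\<close>
  have "lie_dim (d_even m) = 3 * m"
    using m by (simp add: d_even_def lie_dim_def basis_lie_of_table)
  then show "num_invariants (d_even m) = m - 2"
    using max_rank_d_even[OF m] by (simp add: num_invariants_def)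
next
  fix m :: nat assume m: "m \<ge> 2"
  have "lie_dim (d_odd m) = 3 * m + 1"
    using m by (simp add: d_odd_def lie_dim_def basis_lie_of_table)
  then show "num_invariants (d_odd m) = m - 1"
    using max_rank_d_odd[OF m] by (simp add: num_invariants_def)
next
  have "lie_dim d5' = 7"
    by (simp add: d5'_def lie_dim_def basis_lie_of_table)
  then show "num_invariants d5' = 1"
    using max_rank_d5' by (simp add: num_invariants_def)
qed

end
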